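(* Let $N\ge 1$, let $\{(x_k,y_k) : 1\le k\le N\}\subset\mathbb{Z}^2$ be a finite set, and let $(\alpha,\beta)\in\mathbb{R}^2$ with $(\alpha,\beta)\notin\mathbb{Z}^2$. Assume that a function $f$ either belongs to $W_0(\mathbb{R})$ or is a Schwartz function on $\mathbb{R}$, and that it satisfies $$\sum_{k=1}^{N} c_k M_{y_k}T_{x_k} f = M_\alpha T_\beta f,$$ where $c_1,\dots,c_N$ are nonzero complex coefficients. Let $Zf$ be the Zak transform of $f$ and let $\mathrm{zero}(Zf)=\{z\in[0,1)^2 : Zf(z)=0\}$ be its zero set. Then the following statements hold: 1. Let $\alpha_{(-\beta,\alpha)}:[0,1)^2\to[0,1)^2$ be the bijective map $\alpha_{(-\beta,\alpha)}(z)=(z+(-\beta,\alpha)) \bmod \mathbb{Z}^2$. Then $\mathrm{zero}(Zf)$ is $\alpha_{(-\beta,\alpha)}$-invariant, i.e. $\alpha_{(-\beta,\alpha)}(\mathrm{zero}(Zf))\subseteq \mathrm{zero}(Zf)$. 2. If $\dim_{\mathbb{Q}}(\mathbb{Q}+\mathbb{Q}\alpha+\mathbb{Q}\beta)=2$, then $\mathrm{zero}(Zf)$ is not finite. 3. If $\dim_{\mathbb{Q}}(\mathbb{Q}+\mathbb{Q}\alpha+\mathbb{Q}\beta)=3$, then $f$ is the zero function.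
   Context: For $(x,y)\in\mathbb{R}^2$ and $f:\mathbb{R}\to\mathbb{C}$, the time-frequency shift of $f$ is $M_yT_xf(t)=e^{-2\pi i y t}f(t-x)$ (note the minus sign in the modulation). The Wiener amalgam space $W(\mathbb{R})$ consists of the measurable functions $f:\mathbb{R}\to\mathbb{C}$ with $\|f\|_{W(\mathbb{R})}=\sum_{n\in\mathbb{Z}}\operatorname{ess\,sup}_{x\in[0,1]}|f(x+n)|<\infty$. Let $C(\mathbb{R})$ be the space of continuous functions on $\mathbb{R}$ and set $W_0(\mathbb{R})=C(\mathbb{R})\cap W(\mathbb{R})$. One has $S(\mathbb{R})\subset W_0(\mathbb{R})\subset L^1(\mathbb{R})\cap L^2(\mathbb{R})$, where $S(\mathbb{R})$ denotes the Schwartz functions. The Zak transform of $f$ is $Zf(t,\omega)=\sum_{k\in\mathbb{Z}}f(t+k)e^{-2\pi i k\omega}$ for $(t,\omega)\in\mathbb{R}^2$; for $f\in W_0(\mathbb{R})$ it is defined pointwise by this series. $\mathbb{Q}+\mathbb{Q}\alpha+\mathbb{Q}\beta$ denotes the $\mathbb{Q}$-linear span of $1,\alpha,\beta$ in $\mathbb{R}$. A set $E\subseteq[0,1)^2$ is called invariant under a map $T:[0,1)^2\to[0,1)^2$ if $T(E)\subseteq E$. *)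

theory Defs
  imports "HOL-Probability.Essential_Supremum"
begin

text \<open>The modulation carries a minus sign in the exponent.\<close>

definition translation :: "real \<Rightarrow> (real \<Rightarrow> complex) \<Rightarrow> real \<Rightarrow> complex" where
  "translation x f = (\<lambda>t. f (t - x))"

definition modulation :: "real \<Rightarrow> (real \<Rightarrow> complex) \<Rightarrow> real \<Rightarrow> complex" where
  "modulation y f = (\<lambda>t. exp (- (2 * of_real pi * \<i> * of_real y * of_real t)) * f t)"

text \<open>The amalgam norm takes its value in the extended non-negative reals, so that both the
  essential suprema and the series are always meaningful. Its elements are functions,
  not equivalence classes modulo null sets.\<close>

definition wiener_norm :: "(real \<Rightarrow> complex) \<Rightarrow> ennreal" where
  "wiener_norm f =
     (\<Sum>\<^sub>\<infinity>n::int. esssup (lebesgue_on {0..1}) (\<lambda>x. ennreal (cmod (f (x + of_int n)))))"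

definition wiener_amalgam :: "(real \<Rightarrow> complex) set" where
  "wiener_amalgam = {f \<in> borel_measurable lebesgue. wiener_norm f < \<infinity>}"

definition wiener_amalgam0 :: "(real \<Rightarrow> complex) set" where
  "wiener_amalgam0 = {f. continuous_on UNIV f} \<inter> wiener_amalgam"

definition iter_deriv :: "nat \<Rightarrow> (real \<Rightarrow> complex) \<Rightarrow> real \<Rightarrow> complex" where
  "iter_deriv n = (\<lambda>g t. vector_derivative g (at t)) ^^ n"

definition schwartz_space :: "(real \<Rightarrow> complex) set" where
  "schwartz_space =
     {f. (\<forall>n t. iter_deriv n f differentiable (at t)) \<and>
         (\<forall>m n. bounded (range (\<lambda>t. of_real (t ^ m) * iter_deriv n f t)))}"

text \<open>For \<open>f\<close> in \<^const>\<open>wiener_amalgam0\<close>, in particular for Schwartz functions, the series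
  converges absolutely at every point. Where it is not summable, \<^const>\<open>infsum\<close> returns 0.\<close>

definition zak :: "(real \<Rightarrow> complex) \<Rightarrow> real \<times> real \<Rightarrow> complex" where
  "zak f = (\<lambda>(t, \<omega>).
     \<Sum>\<^sub>\<infinity>k::int. f (t + of_int k) * exp (- (2 * of_real pi * \<i> * of_int k * of_real \<omega>)))"

definition zak_zeros :: "(real \<Rightarrow> complex) \<Rightarrow> (real \<times> real) set" where
  "zak_zeros f = {z \<in> {0..<1} \<times> {0..<1}. zak f z = 0}"

definition torus_shift :: "real \<times> real \<Rightarrow> real \<times> real \<Rightarrow> real \<times> real" where
  "torus_shift v z = (frac (fst (z + v)), frac (snd (z + v)))"

lemma frac_shift_cancel:
  fixes x a b :: real
  assumes "x \<in> {0..<1}" "a + b \<in> \<int>"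
  shows "frac (frac (x + a) + b) = x"
proof -
  have "frac (x + a) + b - x = (a + b) - of_int \<lfloor>x + a\<rfloor>"
    by (simp add: frac_def)
  then have "frac (x + a) + b - x \<in> \<int>"
    using assms(2) by (simp only: Ints_diff Ints_of_int)
  then show ?thesis
    using assms(1) frac_unique_iff[of "frac (x + a) + b" x] by (auto simp: minus_diff_commute)
qed

lemma bij_betw_torus_shift:
  "bij_betw (torus_shift v) ({0..<1} \<times> {0..<1}) ({0..<1} \<times> {0..<1})"
  by (rule bij_betw_byWitness[where f' = "torus_shift (- v)"])
     (auto simp: torus_shift_def frac_lt_1 frac_shift_cancel
        frac_shift_cancel[where b = "- _", simplified])

text \<open>The real numbers as a vector space over the rational numbers.\<close>

global_interpretation rat_real: vector_space "\<lambda>(q::rat) (x::real). of_rat q * x"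
  by unfold_locales (simp_all add: algebra_simps of_rat_add of_rat_mult)

end

theory Submission
  imports Defs
begin

text \<open>The Zak transform turns the equation into \<open>p(t, \<omega>) Zf(t, \<omega>) = e^(-2\<pi>i\<alpha>t) Zf(t - \<beta>, \<omega> + \<alpha>)\<close>
  with a trigonometric polynomial \<open>p\<close>, so the zeros of \<open>Zf\<close> are invariant under the shift by
  \<open>(-\<beta>, \<alpha>)\<close>. As \<open>Zf\<close> is continuous and quasiperiodic, it has a zero. A finite zero set would
  contain a periodic orbit, forcing \<open>\<alpha>\<close> and \<open>\<beta>\<close> to be rational. If \<open>1, \<alpha>, \<beta>\<close> are rationally
  independent, Kronecker's theorem makes the orbit of the zero dense, hence \<open>Zf = 0\<close> and \<open>f = 0\<close>.\<close>

section \<open>Unimodular phases and covariance of the Zak transform\<close>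

text \<open>One character serves both the modulation and the Zak kernel: its sign matches theirs,
  and \<open>cis\<close> makes norm and product immediate.\<close>

definition phase :: "real \<Rightarrow> complex" where
  "phase x = cis (- (2 * pi * x))"

lemma phase_add: "phase (a + b) = phase a * phase b"
  by (simp add: phase_def cis_mult algebra_simps)

lemma phase_of_int [simp]: "phase (of_int n) = 1"
proof -
  have "- (2 * pi * of_int n) = 2 * pi * of_int (- n)"
    by simp
  then show ?thesis
    unfolding phase_def by (metis cis_multiple_2pi Ints_of_int)
qed

lemma phase_nonzero [simp]: "phase x \<noteq> 0"
  by (simp add: phase_def)

lemma norm_phase [simp]: "cmod (phase x) = 1"
  by (simp add: phase_def)

lemma continuous_on_phase [continuous_intros]:
  "continuous_on A g \<Longrightarrow> continuous_on A (\<lambda>x. phase (g x))"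
  unfolding phase_def by (intro continuous_intros)

lemma exp_eq_phase: "exp (- (2 * of_real pi * \<i> * of_real a * of_real b)) = phase (a * b)"
  by (simp add: phase_def cis_conv_exp algebra_simps)

lemma phase_conv_exp: "phase x = exp (- (2 * of_real pi * \<i> * of_real x))"
  by (simp add: phase_def cis_conv_exp algebra_simps)

lemma modulation_eq: "modulation y f t = phase (y * t) * f t"
  by (simp add: modulation_def exp_eq_phase)

lemma zak_eq: "zak f (t, \<omega>) = (\<Sum>\<^sub>\<infinity>k::int. f (t + of_int k) * phase (of_int k * \<omega>))"
  by (simp add: zak_def flip: exp_eq_phase)

text \<open>Reindexing by \<open>n\<close> pulls out a unimodular factor. Both operations respect
  \<open>infsum\<close> even where it takes its default value 0, hence the form for arbitrary
  \<open>f\<close>.\<close>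

lemma zak_shift_time: "zak f (t + of_int n, \<omega>) = phase (- (of_int n * \<omega>)) * zak f (t, \<omega>)"
proof -
  have "zak f (t, \<omega>) = (\<Sum>\<^sub>\<infinity>k::int. f (t + of_int (k + n)) * phase (of_int (k + n) * \<omega>))"
    unfolding zak_eq
    by (rule infsum_reindex_bij_witness[of _ "\<lambda>k. k + n" "\<lambda>k. k - n"]) auto
  also have "\<dots> = (\<Sum>\<^sub>\<infinity>k::int. phase (of_int n * \<omega>) * (f (t + of_int n + of_int k) * phase (of_int k * \<omega>)))"
    by (intro infsum_cong) (simp add: phase_add distrib_right add_ac)
  also have "\<dots> = phase (of_int n * \<omega>) * zak f (t + of_int n, \<omega>)"
    by (simp add: zak_eq infsum_cmult_right')
  finally have "phase (- (of_int n * \<omega>)) * zak f (t, \<omega>)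
      = phase (- (of_int n * \<omega>) + of_int n * \<omega>) * zak f (t + of_int n, \<omega>)"
    by (simp only: phase_add mult.assoc)
  then show ?thesis
    using phase_of_int[of 0] by simp
qed

lemma zak_shift_freq: "zak f (t, \<omega> + of_int n) = zak f (t, \<omega>)"
proof -
  have "phase (of_int k * (\<omega> + of_int n)) = phase (of_int k * \<omega>)" for k
    using phase_of_int[of "k * n"] by (simp add: phase_add distrib_left)
  then show ?thesis
    by (simp add: zak_eq)
qed

text \<open>\<open>zak f\<close> is only quasiperiodic, but the factor picked up never vanishes, so
  being a zero is periodic modulo the integer lattice. Zeros can thus be tracked in the plane and
  reduced to the unit square at the end.\<close>

lemma zak_shift_eq_0_iff: "zak f (t + of_int m, \<omega> + of_int n) = 0 \<longleftrightarrow> zak f (t, \<omega>) = 0"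
  by (simp add: zak_shift_time zak_shift_freq)

lemma zak_frac_eq_0_iff: "zak f (frac t, frac \<omega>) = 0 \<longleftrightarrow> zak f (t, \<omega>) = 0"
  using zak_shift_eq_0_iff[of f t "- \<lfloor>t\<rfloor>" \<omega> "- \<lfloor>\<omega>\<rfloor>"] by (simp add: frac_def)

text \<open>The modulating phase at \<open>t + k\<close> splits into \<open>phase (a * t)\<close>
  and \<open>phase (k * a)\<close>; the latter joins the kernel and becomes the frequency
  shift.\<close>

lemma zak_modulation_translation:
  "zak (modulation a (translation b f)) (t, \<omega>) = phase (a * t) * zak f (t - b, \<omega> + a)"
proof -
  have "zak (modulation a (translation b f)) (t, \<omega>)
      = (\<Sum>\<^sub>\<infinity>k::int. phase (a * t) * (f (t - b + of_int k) * phase (of_int k * (\<omega> + a))))"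
    unfolding zak_eq
    by (intro infsum_cong) (simp add: modulation_eq translation_def phase_add algebra_simps)
  then show ?thesis
    by (simp add: zak_eq infsum_cmult_right')
qed

section \<open>Convergence, continuity and inversion of the Zak transform\<close>

text \<open>Serves to exchange the finite combination in the equation with the Zak series.
  \<open>has_sum\<close> records the convergence that this exchange rests on.\<close>

lemma has_sum_finite_sum:
  fixes f :: "'i \<Rightarrow> 'a \<Rightarrow> 'b::topological_comm_monoid_add"
  assumes "\<And>i. i \<in> I \<Longrightarrow> (f i has_sum s i) A"
  shows "((\<lambda>a. \<Sum>i\<in>I. f i a) has_sum (\<Sum>i\<in>I. s i)) A"
proof -
  have "((\<lambda>F. \<Sum>i\<in>I. sum (f i) F) \<longlongrightarrow> (\<Sum>i\<in>I. s i)) (finite_subsets_at_top A)"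
    using assms unfolding has_sum_def by (intro tendsto_sum) auto
  moreover have "(\<Sum>a\<in>F. \<Sum>i\<in>I. f i a) = (\<Sum>i\<in>I. sum (f i) F)" for F
    by (rule sum.swap)
  ultimately show ?thesis
    unfolding has_sum_def by presburger
qed

text \<open>What Wiener amalgam and Schwartz functions have in common: the Zak series is dominated
  on unit strips, hence converges locally uniformly.\<close>

locale dominated =
  fixes f :: "real \<Rightarrow> complex" and M :: "int \<Rightarrow> real"
  assumes continuous: "continuous_on UNIV f"
    and summable: "M summable_on UNIV"
    and bound: "\<And>k t. t \<in> {0..1} \<Longrightarrow> cmod (f (t + of_int k)) \<le> M k"
begin

lemma M_nonneg: "0 \<le> M k"
  using norm_ge_zero bound[of 0 k] by (rule order_trans) simp

text \<open>The strip consists of two unit cells, and the sum of their bounds dominates both. Width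
  two lets the interiors of such strips cover the integers as well.\<close>

lemma bound_strip:
  assumes "t \<in> {of_int m - 1..of_int m + 1}"
  shows "cmod (f (t + of_int k)) \<le> M (k + m - 1) + M (k + m)"
proof (cases "t \<le> of_int m")
  case True
  then have "cmod (f (t + of_int k)) \<le> M (k + m - 1)"
    using assms bound[of "t - of_int m + 1" "k + m - 1"] by (simp add: algebra_simps)
  then show ?thesis
    using M_nonneg[of "k + m"] by simp
next
  case False
  then have "cmod (f (t + of_int k)) \<le> M (k + m)"
    using assms bound[of "t - of_int m" "k + m"] by (simp add: algebra_simps)
  then show ?thesis
    using M_nonneg[of "k + m - 1"] by simp
qed

lemma summable_shift: "(\<lambda>k. M (k + m)) summable_on UNIV"
  using summable
  by (subst summable_on_reindex_bij_witness[of UNIV "\<lambda>k. k - m" "\<lambda>k. k + m" UNIV M]) auto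

lemma summable_strip: "(\<lambda>k. M (k + m - 1) + M (k + m)) summable_on UNIV"
  using summable_on_add[OF summable_shift[of "m - 1"] summable_shift[of m]]
  by (simp add: algebra_simps)

text \<open>Weierstrass M-test with the strip bounds. The modulus of each term is independent of the
  frequency, so the strip may be unbounded in that direction.\<close>

lemma uniform_limit_zak:
  fixes m :: int
  assumes "S \<subseteq> {of_int m - 1..of_int m + 1} \<times> UNIV"
  shows "uniform_limit S (\<lambda>K z. \<Sum>k\<in>K. f (fst z + of_int k) * phase (of_int k * snd z))
    (zak f) (finite_subsets_at_top UNIV)"
proof -
  have "uniform_limit S (\<lambda>K z. \<Sum>k\<in>K. f (fst z + of_int k) * phase (of_int k * snd z))
      (\<lambda>z. \<Sum>\<^sub>\<infinity>k. f (fst z + of_int k) * phase (of_int k * snd z)) (finite_subsets_at_top UNIV)"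
  proof (rule Weierstrass_m_test_general[OF _ summable_strip[of m]])
    fix k z assume "z \<in> S"
    then have "fst z \<in> {of_int m - 1..of_int m + 1}"
      using assms by (auto simp: mem_Times_iff)
    then show "cmod (f (fst z + of_int k) * phase (of_int k * snd z)) \<le> M (k + m - 1) + M (k + m)"
      using bound_strip by (simp add: norm_mult)
  qed
  then show ?thesis
    by (simp add: zak_eq[symmetric])
qed

lemma continuous_f [continuous_intros]: "continuous_on A g \<Longrightarrow> continuous_on A (\<lambda>x. f (g x))"
  by (rule continuous_on_compose2[OF continuous]) auto

lemma continuous_zak: "continuous_on UNIV (zak f)"
proof -
  \<comment> \<open>Overlapping open strips centred at the integers cover the plane, and continuity
    glues along an open cover.\<close>
  define S where "S m = {of_int m - 1<..<of_int m + (1::real)} \<times> (UNIV :: real set)" for m :: int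
  have "continuous_on (S m) (zak f)" for m
    by (rule uniform_limit_theorem[OF _ uniform_limit_zak[of _ m]])
      (auto simp: S_def intro!: always_eventually continuous_intros)
  moreover have "open (S m)" for m
    unfolding S_def by (intro open_Times) auto
  ultimately have "continuous_on (\<Union>m. S m) (zak f)"
    by (intro continuous_on_open_UN) simp_all
  moreover have "(\<Union>m. S m) = UNIV"
  proof -
    have "z \<in> S \<lfloor>fst z\<rfloor>" for z
      unfolding S_def mem_Times_iff by simp linarith
    then show ?thesis by blast
  qed
  ultimately show ?thesis by simp
qed

lemma has_sum_zak: "((\<lambda>k. f (t + of_int k) * phase (of_int k * \<omega>)) has_sum zak f (t, \<omega>)) UNIV"
proof -
  have t: "t \<in> {of_int \<lfloor>t\<rfloor> - 1..of_int \<lfloor>t\<rfloor> + 1}"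
    by simp linarith
  have "(\<lambda>k. M (k + \<lfloor>t\<rfloor> - 1) + M (k + \<lfloor>t\<rfloor>)) summable_on UNIV"
    by (rule summable_strip)
  then have "(\<lambda>k. norm (f (t + of_int k) * phase (of_int k * \<omega>))) summable_on UNIV"
    by (rule Infinite_Sum.abs_summable_on_comparison_test')
      (use bound_strip[OF t] in \<open>simp add: norm_mult\<close>)
  then show ?thesis
    unfolding zak_eq by (rule has_sum_infsum[OF abs_summable_summable])
qed

text \<open>The zeroth Fourier coefficient of \<open>\<omega> \<mapsto> zak f (t, \<omega>)\<close> is \<open>f t\<close>.\<close>

lemma eq_0_if_zak_eq_0:
  assumes "\<And>\<omega>. zak f (t, \<omega>) = 0"
  shows "f t = 0"
proof -
  let ?g = "\<lambda>K \<omega>. \<Sum>k\<in>K. f (t + of_int k) * phase (of_int k * \<omega>)"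
  have "uniform_limit ((\<lambda>\<omega>. (t, \<omega>)) ` cbox 0 1)
      (\<lambda>K z. \<Sum>k\<in>K. f (fst z + of_int k) * phase (of_int k * snd z)) (zak f)
      (finite_subsets_at_top UNIV)"
    by (rule uniform_limit_zak[of _ "\<lfloor>t\<rfloor>"]) (simp add: image_subset_iff, linarith)
  \<comment> \<open>On this vertical line the limit is the zero function; uniform convergence
    permits integration over one period.\<close>
  then have "uniform_limit (cbox 0 1) ?g (\<lambda>\<omega>. 0) (finite_subsets_at_top UNIV)"
    by (simp add: uniform_limit_iff assms)
  then obtain I J where I: "\<And>K. (?g K has_integral I K) (cbox 0 1)"
    and J: "((\<lambda>\<omega>. 0) has_integral J) (cbox (0::real) 1)"
    and lim: "(I \<longlongrightarrow> J) (finite_subsets_at_top UNIV)"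
    by (rule uniform_limit_integral_cbox[where F = "finite_subsets_at_top UNIV"])
      (auto intro!: continuous_intros)
  have phase_integral: "integral {0..1} (\<lambda>\<omega>. phase (of_int k * \<omega>)) = (if k = 0 then 1 else 0)"
    for k :: int
  proof (cases "k = 0")
    case True
    then show ?thesis using phase_of_int[of 0] by simp
  next
    case False
    have "integral {0..1} (\<lambda>\<omega>. phase (of_int k * \<omega>))
        = integral {0..1} (\<lambda>\<omega>. exp (- (2 * of_real pi * \<i> * of_int k) * complex_of_real \<omega>))"
      by (simp add: phase_conv_exp mult_ac)
    also have "\<dots> = (phase (of_int k) - 1) / (- (2 * of_real pi * \<i> * of_int k))"
      using False by (subst integral_exp) (auto simp: phase_conv_exp)
    finally show ?thesis using False by simp
  qed
  \<comment> \<open>Once \<open>K\<close> contains 0, orthogonality leaves only the term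
    \<open>k = 0\<close>. So the integrals are eventually \<open>f t\<close>, while they tend to the
    integral of 0.\<close>
  have "I K = f t" if "0 \<in> K" "finite K" for K
  proof -
    have "I K = integral {0..1} (?g K)"
      using I[of K] by (simp add: integral_unique)
    also have "\<dots> = (\<Sum>k\<in>K. f (t + of_int k) * integral {0..1} (\<lambda>\<omega>. phase (of_int k * \<omega>)))"
      using that
      by (subst integral_sum) (auto intro!: integrable_continuous_interval continuous_intros)
    also have "\<dots> = (\<Sum>k\<in>K. if k = 0 then f t else 0)"
      by (rule sum.cong) (auto simp: phase_integral)
    finally show ?thesis using that by simp
  qed
  then have "eventually (\<lambda>K. I K = f t) (finite_subsets_at_top UNIV)"
    unfolding eventually_finite_subsets_at_top by (intro exI[of _ "{0}"]) auto
  then have "(I \<longlongrightarrow> f t) (finite_subsets_at_top UNIV)"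
    by (rule tendsto_eventually)
  then have "f t = J"
    using lim by (intro tendsto_unique[of "finite_subsets_at_top UNIV" I]) auto
  also have "J = 0"
    using J by (rule has_integral_unique) simp
  finally show ?thesis .
qed

end

section \<open>Domination for Wiener amalgam and Schwartz functions\<close>

text \<open>Inside the open interval the bound fails on an open null set, which must be empty; the
  endpoints follow by closure.\<close>

lemma AE_lebesgue_on_continuous_le:
  fixes g :: "real \<Rightarrow> real"
  assumes g: "continuous_on UNIV g" and "a < b" and AE: "AE x in lebesgue_on {a..b}. g x \<le> C"
    and x: "x \<in> {a..b}"
  shows "g x \<le> C"
proof -
  let ?U = "{x \<in> {a<..<b}. C < g x}"
  have "open ?U"
  proof -
    have "open ({a<..<b} \<inter> {x. C < g x})"
      by (intro open_Int open_Collect_less open_greaterThanLessThan continuous_on_const g)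
    then show ?thesis by (simp add: Int_def)
  qed
  have "AE x in lebesgue. x \<in> {a..b} \<longrightarrow> g x \<le> C"
    using AE by (simp add: AE_restrict_space_iff)
  then have "AE x in lebesgue. x \<notin> ?U"
    by eventually_elim auto
  then have "?U \<in> null_sets lebesgue"
    using \<open>open ?U\<close> by (subst AE_iff_null_sets) (auto intro: borel_open)
  then have "negligible ?U"
    by (simp add: negligible_iff_null_sets)
  then have "?U = {}"
    using \<open>open ?U\<close> open_not_negligible by blast
  then have "{a<..<b} \<subseteq> {x. g x \<le> C}"
    by (fastforce simp: not_less)
  moreover have "closed {x. g x \<le> C}"
    using g by (intro closed_Collect_le continuous_intros) auto
  ultimately have "closure {a<..<b} \<subseteq> {x. g x \<le> C}"
    by (rule closure_minimal)
  then show ?thesis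
    using \<open>a < b\<close> x by (auto simp: closure_greaterThanLessThan)
qed

lemma wiener_amalgam0_dominated:
  assumes "f \<in> wiener_amalgam0"
  shows "\<exists>M. dominated f M"
proof -
  have cont: "continuous_on UNIV f" and fin: "wiener_norm f < \<infinity>"
    using assms by (auto simp: wiener_amalgam0_def wiener_amalgam_def)
  define m where
    "m n = esssup (lebesgue_on {0..1}) (\<lambda>x. ennreal (cmod (f (x + of_int n))))" for n :: int
  \<comment> \<open>An infinite sum in \<open>ennreal\<close> is the supremum of its finite partial
    sums. Hence every \<open>m n\<close> is finite and \<open>enn2real\<close> loses
    nothing.\<close>
  have sum_le: "sum m K \<le> wiener_norm f" if "finite K" for K
    unfolding wiener_norm_def m_def[symmetric] using that
    by (auto simp: nonneg_infsum_complete intro!: SUP_upper)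
  have m_fin: "m n < \<infinity>" for n
    using sum_le[of "{n}"] fin by (simp add: le_less_trans)
  have "dominated f (\<lambda>n. enn2real (m n))"
  proof
    show "(\<lambda>n. enn2real (m n)) summable_on UNIV"
    proof (rule nonneg_bdd_above_summable_on)
      show "bdd_above (sum (\<lambda>n. enn2real (m n)) ` {K. K \<subseteq> UNIV \<and> finite K})"
      proof (rule bdd_aboveI2)
        fix K :: "int set" assume "K \<in> {K. K \<subseteq> UNIV \<and> finite K}"
        then have "(\<Sum>n\<in>K. enn2real (m n)) = enn2real (sum m K)"
          using m_fin by (simp add: enn2real_sum)
        also have "\<dots> \<le> enn2real (wiener_norm f)"
          using \<open>K \<in> _\<close> sum_le fin by (intro enn2real_mono) auto
        finally show "(\<Sum>n\<in>K. enn2real (m n)) \<le> enn2real (wiener_norm f)" .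
      qed
    qed auto
    fix k :: int and t :: real assume t: "t \<in> {0..1}"
    have "AE x in lebesgue_on {0..1}. ennreal (cmod (f (x + of_int k))) \<le> m k"
      unfolding m_def by (rule esssup_AE)
    then have "AE x in lebesgue_on {0..1}. cmod (f (x + of_int k)) \<le> enn2real (m k)"
    proof eventually_elim
      case (elim x)
      then show ?case
        using enn2real_mono[OF elim] m_fin[of k] by simp
    qed
    moreover have "continuous_on UNIV (\<lambda>x. cmod (f (x + of_int k)))"
      by (intro continuous_intros continuous_on_compose2[OF cont]) auto
    ultimately show "cmod (f (t + of_int k)) \<le> enn2real (m k)"
      using AE_lebesgue_on_continuous_le t zero_less_one by blast
  qed (rule cont)
  then show ?thesis by blast
qed

text \<open>The majorant for Schwartz functions. The integers are covered by two copies of the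
  naturals, which overlap only in 0.\<close>

lemma summable_on_int_inverse_square: "(\<lambda>k::int. 1 / (1 + (of_int k)\<^sup>2 :: real)) summable_on UNIV"
proof -
  have "summable (\<lambda>n::nat. 1 / (1 + (real n)\<^sup>2))"
  proof (rule summable_comparison_test'[where N = 1])
    show "summable (\<lambda>n. 1 / (real n)\<^sup>2)"
      using inverse_power_summable[of 2] by (simp add: inverse_eq_divide)
  qed (auto simp: divide_simps add_pos_nonneg)
  then have nat: "(\<lambda>n::nat. 1 / (1 + (real n)\<^sup>2)) summable_on UNIV"
    by (subst summable_on_UNIV_nonneg_real_iff) auto
  have "(\<lambda>k::int. 1 / (1 + (of_int k)\<^sup>2 :: real)) summable_on range int"
    by (subst summable_on_reindex) (use nat in \<open>auto simp: o_def\<close>)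
  moreover have "(\<lambda>k::int. 1 / (1 + (of_int k)\<^sup>2 :: real)) summable_on range (\<lambda>n. - int n)"
    by (subst summable_on_reindex) (use nat in \<open>auto simp: o_def inj_on_def\<close>)
  ultimately have "(\<lambda>k::int. 1 / (1 + (of_int k)\<^sup>2 :: real))
      summable_on (range int \<union> range (\<lambda>n. - int n))"
    by (rule summable_on_union)
  moreover have "range int \<union> range (\<lambda>n. - int n) = UNIV"
    by (auto simp: image_iff) (metis int_cases2)
  ultimately show ?thesis by simp
qed

lemma schwartz_space_dominated:
  assumes "f \<in> schwartz_space"
  shows "\<exists>M. dominated f M"
proof -
  have "f differentiable (at t)" for t
  proof -
    have "iter_deriv 0 f differentiable (at t)"
      using assms unfolding schwartz_space_def by blast
    then show ?thesis by (simp add: iter_deriv_def)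
  qed
  then have cont: "continuous_on UNIV f"
    by (simp add: continuous_at_imp_continuous_on differentiable_imp_continuous_within)
  have "bounded (range (\<lambda>t. of_real (t ^ m) * f t))" for m
  proof -
    have "bounded (range (\<lambda>t. of_real (t ^ m) * iter_deriv 0 f t))"
      using assms unfolding schwartz_space_def by blast
    then show ?thesis by (simp add: iter_deriv_def)
  qed
  \<comment> \<open>The weights of degree 0 and 2 add up to decay of order
    \<open>1 / (1 + t^2)\<close>, which is summable over the integers.\<close>
  from this[of 0] this[of 2] obtain A B where
    "\<And>t. cmod (f t) \<le> A" and "\<And>t. cmod (of_real (t\<^sup>2) * f t) \<le> B"
    by (auto simp: bounded_iff)
  then have decay: "(1 + t\<^sup>2) * cmod (f t) \<le> A + B" for t
    using add_mono[of "cmod (f t)" A "cmod (of_real (t\<^sup>2) * f t)" B]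
    by (simp add: norm_mult norm_power algebra_simps)
  have "dominated f (\<lambda>k. 3 * (A + B) * (1 / (1 + (of_int k)\<^sup>2)))"
  proof
    show "(\<lambda>k. 3 * (A + B) * (1 / (1 + (of_int k)\<^sup>2))) summable_on UNIV"
      by (intro summable_on_cmult_right summable_on_int_inverse_square)
    fix k :: int and t :: real assume t: "t \<in> {0..1}"
    define s where "s = t + of_int k"
    \<comment> \<open>Parallelogram identity for \<open>k = s - t\<close>. With
      \<open>t^2 \<le> 1\<close> it gives \<open>1 + k^2 \<le> 3 + 2 * s^2\<close>, whence the
      constant 3.\<close>
    have "(of_int k)\<^sup>2 = 2 * s\<^sup>2 + 2 * t\<^sup>2 - (s + t)\<^sup>2"
      by (simp add: s_def power2_eq_square algebra_simps)
    moreover have "0 \<le> (s + t)\<^sup>2" "t\<^sup>2 \<le> 1" "0 \<le> s\<^sup>2"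
      using t by (auto intro: power_le_one)
    ultimately have "1 + (of_int k)\<^sup>2 \<le> 3 * (1 + s\<^sup>2)"
      unfolding distrib_left by linarith
    then have "(1 + (of_int k)\<^sup>2) * cmod (f s) \<le> 3 * (1 + s\<^sup>2) * cmod (f s)"
      by (rule mult_right_mono) simp
    also have "\<dots> \<le> 3 * (A + B)"
      unfolding mult.assoc by (intro mult_left_mono decay) simp
    finally show "cmod (f (t + of_int k)) \<le> 3 * (A + B) * (1 / (1 + (of_int k)\<^sup>2))"
      by (simp add: s_def field_simps add_pos_nonneg)
  qed (rule cont)
  then show ?thesis by blast
qed

section \<open>Zeros of quasiperiodic functions\<close>

text \<open>The values are integer multiples of \<open>2 * pi * \<i>\<close>, hence at distance at
  least \<open>2 * pi\<close> when distinct; a continuous function on a connected set cannot jump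
  between them.\<close>

lemma continuous_exp_eq_1_constant:
  fixes h :: "'a::topological_space \<Rightarrow> complex"
  assumes "connected S" "continuous_on S h" and exp: "\<And>x. x \<in> S \<Longrightarrow> exp (h x) = 1"
  shows "h constant_on S"
proof (rule continuous_discrete_range_constant[OF assms(1,2)])
  fix x assume "x \<in> S"
  have "2 * pi \<le> cmod (h y - h x)" if "y \<in> S" "h y \<noteq> h x" for y
  proof -
    obtain m n :: int where "Re (h x) = 0" "Re (h y) = 0"
      and mn: "Im (h x) = of_int (2 * m) * pi" "Im (h y) = of_int (2 * n) * pi"
      using exp[OF \<open>x \<in> S\<close>] exp[OF \<open>y \<in> S\<close>] by (auto simp: exp_eq_1)
    then have "m \<noteq> n"
      using that complex_eqI by auto
    then have "1 \<le> \<bar>of_int (n - m) :: real\<bar>"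
      by linarith
    then have "2 * pi \<le> 2 * pi * \<bar>of_int (n - m)\<bar>"
      by simp
    also have "\<dots> = \<bar>2 * pi * of_int (n - m)\<bar>"
      by (simp add: abs_mult)
    also have "2 * pi * of_int (n - m) = Im (h y - h x)"
      by (simp add: mn algebra_simps)
    also have "\<bar>\<dots>\<bar> \<le> cmod (h y - h x)"
      by (rule abs_Im_le_cmod)
    finally show ?thesis .
  qed
  then show "\<exists>e>0. \<forall>y. y \<in> S \<and> h y \<noteq> h x \<longrightarrow> e \<le> cmod (h y - h x)"
    using pi_gt_zero by (intro exI[of _ "2 * pi"]) auto
qed

text \<open>A continuous logarithm would change by inconsistent amounts along the two edge paths
  from \<open>(0, 0)\<close> to \<open>(1, 1)\<close> of the unit square.\<close>

lemma quasiperiodic_has_zero: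
  fixes F :: "real \<times> real \<Rightarrow> complex"
  assumes cont: "continuous_on UNIV F"
    and time: "\<And>t \<omega>. F (t + 1, \<omega>) = phase (- \<omega>) * F (t, \<omega>)"
    and freq: "\<And>t \<omega>. F (t, \<omega> + 1) = F (t, \<omega>)"
  shows "\<exists>z. F z = 0"
proof (rule ccontr)
  assume "\<nexists>z. F z = 0"
  \<comment> \<open>The plane is contractible, so a nowhere vanishing continuous function has a
    continuous logarithm.\<close>
  then obtain g where g: "continuous_on UNIV g" and F: "\<And>z. F z = exp (g z)"
    using continuous_logarithm_on_contractible[OF cont] by (metis UNIV_I contractible_UNIV)
  have cg [continuous_intros]: "continuous_on A h \<Longrightarrow> continuous_on A (\<lambda>x. g (h x))"
    for A :: "(real \<times> real) set" and h
    by (rule continuous_on_compose2[OF g]) auto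
  have nz: "F z \<noteq> 0" for z
    by (simp add: F)
  have "(\<lambda>z. g (fst z, snd z + 1) - g z) constant_on UNIV"
  proof (rule continuous_exp_eq_1_constant)
    show "continuous_on UNIV (\<lambda>z. g (fst z, snd z + 1) - g z)"
      by (intro continuous_intros)
    show "exp (g (fst z, snd z + 1) - g z) = 1" for z
      using nz[of z] by (simp add: exp_diff F[symmetric] freq)
  qed (rule connected_UNIV)
  then obtain A where A: "\<And>t \<omega>. g (t, \<omega> + 1) - g (t, \<omega>) = A"
    by (force simp: constant_on_def)
  \<comment> \<open>The subtracted term is a logarithm of the quasiperiodicity factor
    \<open>phase (- \<omega>)\<close>.\<close>
  have "(\<lambda>z. g (fst z + 1, snd z) - g z - 2 * of_real pi * \<i> * of_real (snd z)) constant_on UNIV"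
  proof (rule continuous_exp_eq_1_constant)
    show "continuous_on UNIV
        (\<lambda>z. g (fst z + 1, snd z) - g z - 2 * of_real pi * \<i> * of_real (snd z))"
      by (intro continuous_intros)
    show "exp (g (fst z + 1, snd z) - g z - 2 * of_real pi * \<i> * of_real (snd z)) = 1" for z
      using nz[of z] by (simp add: exp_diff F[symmetric] time phase_conv_exp)
  qed (rule connected_UNIV)
  then obtain B where B: "\<And>t \<omega>. g (t + 1, \<omega>) - g (t, \<omega>) - 2 * of_real pi * \<i> * of_real \<omega> = B"
    by (force simp: constant_on_def)
  \<comment> \<open>From \<open>(0, 0)\<close> to \<open>(1, 1)\<close>, the path through
    \<open>(1, 0)\<close> gives the increment \<open>A + B\<close>, the path through
    \<open>(0, 1)\<close> gives \<open>A + B + 2 * pi * \<i>\<close>.\<close>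
  have "2 * of_real pi * \<i> = 0"
    using A[of 0 0] A[of 1 0] B[of 0 0] B[of 0 1] by (simp add: algebra_simps)
  then show False by simp
qed

section \<open>Simultaneous Diophantine approximation\<close>

text \<open>Every integer relation is a rational one. This passes from dimension over the rationals
  to the integer independence in Kronecker's theorem.\<close>

lemma int_independent_if_rat_independent:
  assumes "rat_real.independent S"
  shows "module.independent (\<lambda>r x. of_int r * (x::real)) S"
proof -
  interpret Modules.module "\<lambda>r x. of_int r * (x::real)"
    by unfold_locales (simp_all add: algebra_simps)
  show ?thesis
  proof
    assume "dependent S"
    then obtain T u v where T: "finite T" "T \<subseteq> S" "(\<Sum>v\<in>T. of_int (u v) * v) = 0"
      and "v \<in> T" "u v \<noteq> 0"
      unfolding dependent_explicit by blast
    then have "(\<Sum>v\<in>T. of_rat (of_int (u v)) * v) = 0"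
      by simp
    then have "rat_real.dependent S"
      unfolding rat_real.dependent_explicit using T(1,2) \<open>v \<in> T\<close> \<open>u v \<noteq> 0\<close>
      by (intro exI[of _ T] exI[of _ "\<lambda>v. of_int (u v)"]) auto
    with assms show False ..
  qed
qed

text \<open>Kronecker's theorem gives an integer multiplier of unknown sign; adding a large multiple of
  a recurrence time makes it nonnegative.\<close>

lemma Kronecker_forward:
  fixes \<theta> a :: "nat \<Rightarrow> real"
  assumes ind: "module.independent (\<lambda>r x. of_int r * x) (\<theta> ` {..n})"
    and inj: "inj_on \<theta> {..n}" and "\<theta> n = 1" and "\<epsilon> > 0"
  obtains k :: nat and p :: "nat \<Rightarrow> int"
    where "\<And>i. i < n \<Longrightarrow> \<bar>real k * \<theta> i - of_int (p i) - a i\<bar> < \<epsilon>"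
proof -
  obtain k p where k: "\<And>i. i < n \<Longrightarrow> \<bar>of_int k * \<theta> i - of_int (p i) - a i\<bar> < \<epsilon> / 2"
    using Kronecker_thm_2[OF ind inj \<open>\<theta> n = 1\<close>, of "\<epsilon> / 2"] \<open>\<epsilon> > 0\<close> by (metis half_gt_zero)
  \<comment> \<open>Chosen so that \<open>\<bar>k\<bar>\<close> recurrence errors, each below
    \<open>1 / N\<close>, add up to less than the half of \<epsilon> left over by Kronecker's
    theorem.\<close>
  obtain N :: nat where "2 * (\<bar>of_int k\<bar> + 1) / \<epsilon> < real N"
    using reals_Archimedean2 by blast
  moreover from this have "N > 0"
    using \<open>\<epsilon> > 0\<close> by (intro Nat.gr0I) (auto simp: field_simps)
  ultimately have N: "of_int \<bar>k\<bar> * (1 / real N) < \<epsilon> / 2"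
    using \<open>\<epsilon> > 0\<close> by (simp add: field_simps)
  obtain q r where "0 < q" and q: "\<And>i. i < n \<Longrightarrow> \<bar>of_int q * \<theta> i - of_int (r i)\<bar> < 1 / real N"
    using Dirichlet_approx_simult[OF \<open>N > 0\<close>, of n \<theta>] by metis
  have "\<bar>k\<bar> * 1 \<le> \<bar>k\<bar> * q"
    using \<open>0 < q\<close> by (intro mult_left_mono) auto
  then have pos: "0 \<le> k + \<bar>k\<bar> * q"
    by linarith
  show thesis
  proof
    fix i assume i: "i < n"
    have "\<bar>of_int \<bar>k\<bar> * (of_int q * \<theta> i - of_int (r i))\<bar> \<le> of_int \<bar>k\<bar> * (1 / real N)"
      unfolding abs_mult using q[OF i] by (intro mult_mono) auto
    then have "\<bar>(of_int k * \<theta> i - of_int (p i) - a i) +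
        of_int \<bar>k\<bar> * (of_int q * \<theta> i - of_int (r i))\<bar> < \<epsilon>"
      using k[OF i] N by linarith
    then show "\<bar>real (nat (k + \<bar>k\<bar> * q)) * \<theta> i - of_int (p i + \<bar>k\<bar> * r i) - a i\<bar> < \<epsilon>"
      using pos by (simp add: algebra_simps)
  qed
qed

text \<open>The case \<open>n = 2\<close> with frequencies \<alpha>, \<beta> and the normalising 1:
  dimension 3 makes these distinct and independent.\<close>

lemma Kronecker_forward_pair:
  fixes \<alpha> \<beta> u v \<epsilon> :: real
  assumes dim: "rat_real.dim {1, \<alpha>, \<beta>} = 3" and "\<epsilon> > 0"
  obtains k :: nat and p q :: int
  where "\<bar>real k * \<alpha> - of_int p - u\<bar> < \<epsilon>" "\<bar>real k * \<beta> - of_int q - v\<bar> < \<epsilon>"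
proof -
  let ?\<theta> = "\<lambda>i::nat. if i = 0 then \<alpha> else if i = 1 then \<beta> else 1"
  have "rat_real.dim {1, \<alpha>, \<beta>} \<le> card {1, \<alpha>, \<beta>}"
    by (rule rat_real.dim_le_card) (auto intro: rat_real.span_base)
  moreover have "card {1, \<alpha>, \<beta>} \<le> 3"
    by (simp add: card_insert_if)
  ultimately have card: "card {1, \<alpha>, \<beta>} = 3"
    using dim by linarith
  have "rat_real.independent {1, \<alpha>, \<beta>}"
  proof -
    \<comment> \<open>A basis drawn from the three generators has three elements, so it is the whole
      set.\<close>
    obtain B where B: "B \<subseteq> {1, \<alpha>, \<beta>}" "rat_real.independent B" "card B = rat_real.dim {1, \<alpha>, \<beta>}"
      by (rule rat_real.basis_exists)
    then have "B = {1, \<alpha>, \<beta>}"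
      using dim card by (intro card_subset_eq) auto
    with B show ?thesis by simp
  qed
  moreover have image: "?\<theta> ` {..2} = {1, \<alpha>, \<beta>}"
    by (auto simp: numeral_2_eq_2 atMost_Suc)
  ultimately have ind: "module.independent (\<lambda>r x. of_int r * x) (?\<theta> ` {..2})"
    using int_independent_if_rat_independent by simp
  have "card (?\<theta> ` {..2}) = card {..2::nat}"
    unfolding image using card by simp
  then have inj: "inj_on ?\<theta> {..2}"
    by (intro eq_card_imp_inj_on) auto
  obtain k p where k: "\<And>i. i < 2 \<Longrightarrow>
      \<bar>real k * ?\<theta> i - of_int (p i) - (if i = 0 then u else v)\<bar> < \<epsilon>"
    using Kronecker_forward[OF ind inj _ \<open>\<epsilon> > 0\<close>, of "\<lambda>i. if i = 0 then u else v"] by auto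
  show thesis
    using that[of k "p 0" "p 1"] k[of 0] k[of 1] by simp
qed

section \<open>Zeros of the Zak transform under the shift equation\<close>

theorem theorem2:
  fixes N :: nat
    and x y :: "nat \<Rightarrow> int"
    and \<alpha> \<beta> :: real
    and c :: "nat \<Rightarrow> complex"
    and f :: "real \<Rightarrow> complex"
  assumes "N \<ge> 1"
    and "(\<alpha>, \<beta>) \<notin> \<int> \<times> \<int>"
    and "f \<in> wiener_amalgam0 \<or> f \<in> schwartz_space"
    and "\<And>k. k \<in> {1..N} \<Longrightarrow> c k \<noteq> 0"
    and "(\<lambda>t. \<Sum>k=1..N. c k * modulation (of_int (y k)) (translation (of_int (x k)) f) t)
           = modulation \<alpha> (translation \<beta> f)"
  shows "torus_shift (- \<beta>, \<alpha>) ` zak_zeros f \<subseteq> zak_zeros f \<and>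
         (rat_real.dim (rat_real.span {1, \<alpha>, \<beta>}) = 2 \<longrightarrow> infinite (zak_zeros f)) \<and>
         (rat_real.dim (rat_real.span {1, \<alpha>, \<beta>}) = 3 \<longrightarrow> f = (\<lambda>t. 0))"
proof -
  obtain M where "dominated f M"
    using assms(3) wiener_amalgam0_dominated schwartz_space_dominated by blast
  then interpret dominated f M .

  have summand: "((\<lambda>j. modulation (of_int (y k)) (translation (of_int (x k)) f) (t + of_int j) *
        phase (of_int j * \<omega>))
      has_sum phase (of_int (y k) * t) * zak f (t - of_int (x k), \<omega> + of_int (y k))) UNIV"
    for k t \<omega>
  proof -
    have "phase (of_int (y k) * t) * (f (t - of_int (x k) + of_int j) *
        phase (of_int j * (\<omega> + of_int (y k))))
      = modulation (of_int (y k)) (translation (of_int (x k)) f) (t + of_int j) *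
        phase (of_int j * \<omega>)" for j
      by (simp add: modulation_eq translation_def phase_add algebra_simps)
    then show ?thesis
      using has_sum_cmult_right[OF has_sum_zak[of "t - of_int (x k)" "\<omega> + of_int (y k)"],
          of "phase (of_int (y k) * t)"]
      by simp
  qed
  have step: "zak f (t - \<beta>, \<omega> + \<alpha>) = 0" if "zak f (t, \<omega>) = 0" for t \<omega>
  proof -
    have "phase (\<alpha> * t) * zak f (t - \<beta>, \<omega> + \<alpha>) =
        zak (\<lambda>t. \<Sum>k=1..N. c k * modulation (of_int (y k)) (translation (of_int (x k)) f) t) (t, \<omega>)"
      unfolding assms(5) by (simp add: zak_modulation_translation)
    also have "\<dots> =
        (\<Sum>k=1..N. c k * (phase (of_int (y k) * t) * zak f (t - of_int (x k), \<omega> + of_int (y k))))"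
      unfolding zak_eq sum_distrib_right mult.assoc
      by (intro infsumI has_sum_finite_sum has_sum_cmult_right summand[unfolded zak_eq])
    \<comment> \<open>Each term is a multiple of \<open>zak f\<close> at an integer translate of the
      zero \<open>(t, \<omega>)\<close>.\<close>
    also have "\<dots> = 0"
      using that zak_shift_eq_0_iff[of f t "- x k" \<omega> "y k" for k] by simp
    finally show ?thesis by simp
  qed
  have orbit: "zak f (t - real n * \<beta>, \<omega> + real n * \<alpha>) = 0" if "zak f (t, \<omega>) = 0" for t \<omega> n
  proof (induction n)
    case (Suc n)
    then show ?case
      using step[OF Suc] by (simp add: algebra_simps)
  qed (use that in simp)
  obtain s w where zero: "zak f (s, w) = 0"
    using quasiperiodic_has_zero[OF continuous_zak] zak_shift_time[of f _ 1] zak_shift_freq[of f _ _ 1]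
    by (metis surj_pair mult_1 of_int_1)

  have "torus_shift (- \<beta>, \<alpha>) ` zak_zeros f \<subseteq> zak_zeros f"
    using step by (auto simp: zak_zeros_def torus_shift_def zak_frac_eq_0_iff frac_lt_1)

  moreover have "infinite (zak_zeros f)" if dim: "rat_real.dim (rat_real.span {1, \<alpha>, \<beta>}) = 2"
  proof
    assume fin: "finite (zak_zeros f)"
    \<comment> \<open>The orbit of the zero, reduced to the unit square. In a finite zero set it
      must repeat, and a repetition makes a nonzero integer multiple of both \<alpha> and \<beta> an
      integer.\<close>
    let ?o = "\<lambda>n. (frac (s - real n * \<beta>), frac (w + real n * \<alpha>))"
    have "range ?o \<subseteq> zak_zeros f"
      using orbit[OF zero] by (auto simp: zak_zeros_def zak_frac_eq_0_iff frac_lt_1)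
    then have "\<not> inj ?o"
      using fin finite_subset finite_imageD by blast
    then obtain m n where "m \<noteq> n" and
      eq: "frac (s - real m * \<beta>) = frac (s - real n * \<beta>)" "frac (w + real m * \<alpha>) = frac (w + real n * \<alpha>)"
      by (auto simp: inj_on_def)
    have rat: "a \<in> \<rat>" if "(real m - real n) * a \<in> \<int>" for a
    proof -
      have "(real m - real n) * a / (real m - real n) \<in> \<rat>"
        using that by (intro Rats_divide Rats_diff) (auto dest: Ints_subset_Rats[THEN subsetD])
      then show ?thesis using \<open>m \<noteq> n\<close> by simp
    qed
    have "(real m - real n) * \<beta> = of_int (\<lfloor>s - real n * \<beta>\<rfloor> - \<lfloor>s - real m * \<beta>\<rfloor>)"
      "(real m - real n) * \<alpha> = of_int (\<lfloor>w + real m * \<alpha>\<rfloor> - \<lfloor>w + real n * \<alpha>\<rfloor>)"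
      using eq by (simp_all add: frac_def algebra_simps)
    then have "\<alpha> \<in> \<rat>" "\<beta> \<in> \<rat>"
      using rat Ints_of_int by metis+
    moreover have "a \<in> rat_real.span {1}" if "a \<in> \<rat>" for a
      using that rat_real.span_scale[OF rat_real.span_base[of 1 "{1}"]] by (auto elim!: Rats_cases)
    ultimately have "{1, \<alpha>, \<beta>} \<subseteq> rat_real.span {1}"
      by (auto intro: rat_real.span_base)
    \<comment> \<open>Rational \<alpha> and \<beta> lie in the span of 1, so the dimension is at
      most 1 instead of 2.\<close>
    then have "rat_real.dim {1, \<alpha>, \<beta>} \<le> card {1::real}"
      by (intro rat_real.dim_le_card) auto
    with dim show False by simp
  qed

  moreover have "f = (\<lambda>t. 0)" if dim: "rat_real.dim (rat_real.span {1, \<alpha>, \<beta>}) = 3"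
  proof -
    have "(t, \<omega>) \<in> closure {z. zak f z = 0}" for t \<omega>
      unfolding closure_approachable
    proof (intro allI impI)
      fix \<epsilon> :: real assume "\<epsilon> > 0"
      \<comment> \<open>The orbit runs from \<open>(s, w)\<close> backwards in time and forwards in
        frequency, so the targets are \<open>s - t\<close> for \<beta> and
        \<open>\<omega> - w\<close> for \<alpha>, with lattice correction
        \<open>(q, - p)\<close>.\<close>
      then obtain k :: nat and p q :: int where
        k: "\<bar>real k * \<alpha> - of_int p - (\<omega> - w)\<bar> < \<epsilon> / 2" "\<bar>real k * \<beta> - of_int q - (s - t)\<bar> < \<epsilon> / 2"
        using dim Kronecker_forward_pair[of \<alpha> \<beta> "\<epsilon> / 2"] by (metis half_gt_zero rat_real.dim_span)
      let ?z = "(s - real k * \<beta> + of_int q, w + real k * \<alpha> + of_int (- p))"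
      have "zak f ?z = 0"
        using orbit[OF zero] zak_shift_eq_0_iff by blast
      moreover have "dist ?z (t, \<omega>) < \<epsilon>"
      proof -
        have "dist ?z (t, \<omega>) \<le> \<bar>s - real k * \<beta> + of_int q - t\<bar> + \<bar>w + real k * \<alpha> + of_int (- p) - \<omega>\<bar>"
          by (simp add: dist_Pair_Pair dist_real_def)
            (rule sqrt_sum_squares_le_sum_abs[THEN order_trans], simp)
        then show ?thesis using k unfolding of_int_minus by linarith
      qed
      ultimately show "\<exists>z\<in>{z. zak f z = 0}. dist z (t, \<omega>) < \<epsilon>"
        by blast
    qed
    moreover have "closed {z. zak f z = 0}"
      using continuous_zak by (intro closed_Collect_eq) auto
    ultimately have "zak f (t, \<omega>) = 0" for t \<omega>
      by (simp add: closure_closed)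
    then show ?thesis
      using eq_0_if_zak_eq_0 by blast
  qed

  ultimately show ?thesis by blast
qed

end
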